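(* Let $n\ge 0$, let $X\subseteq\{0,1\}^n$ be nonempty, and let $G=Q_n(X)$ be the daisy cube generated by $X$. Then $$D_{G,0^n}(x,y)=W_{G,0^n}(x+y)\quad\text{and}\quad C_G(x)=W_{G,0^n}(x+1).$$
   Context: The $n$-cube $Q_n$ is the graph with vertex set $\{0,1\}^n$, two words being adjacent if they differ in exactly one coordinate ($Q_0=K_1$). $0^n$ is the all-zero word. For $u,v\in\{0,1\}^n$ write $u\le v$ if $u_i\le v_i$ for all $i$. For $X\subseteq\{0,1\}^n$, the daisy cube $Q_n(X)$ generated by $X$ is the subgraph of $Q_n$ induced by $\{u\in\{0,1\}^n : u\le x \text{ for some } x\in X\}$. For a finite graph $G$, $c_k(G)$ ($k\ge0$) is the number of induced subgraphs of $G$ isomorphic to $Q_k$, and the cube polynomial is $C_G(x)=\sum_{k\ge 0}c_k(G)x^k$. For $u\in V(G)$ and a subgraph $H$ of $G$, $d(u,H)=\min_{v\in V(H)}d_G(u,v)$. Let $c_{k,d}(G)$ ($k,d\ge 0$) be the number of induced subgraphs $H$ of $G$ isomorphic to $Q_k$ with $d(u,H)=d$. The distance cube polynomial of $G$ with respect to $u$ is $D_{G,u}(x,y)=\sum_{k,d\ge0}c_{k,d}(G)x^ky^d$. Let $w_d(G)$ be the number of vertices of $G$ at distance $d$ from $u$ in $G$, and set $W_{G,u}(x)=\sum_{d\ge0}w_d(G)x^d$. *)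

theory Defs
  imports
    "Graph_Theory.Graph_Theory"
    "HOL-Library.Groups_Big_Fun"
    "HOL-Computational_Algebra.Polynomial"
begin

text \<open>
  As in \<^theory>\<open>Graph_Theory.Digraph\<close>, an undirected graph is a symmetric digraph: an edge is
  a pair of opposite arcs. Words over \<open>{0,1}\<close> are Boolean lists, with \<open>False\<close> for \<open>0\<close>.
\<close>

type_synonym word_graph = "(bool list, bool list \<times> bool list) pre_digraph"

definition hypercube :: "nat \<Rightarrow> word_graph" where
  "hypercube n = with_proj
     \<lparr> pverts = {u. length u = n},
       parcs = {(u, v). length u = n \<and> length v = n \<and> card {i. i < n \<and> u ! i \<noteq> v ! i} = 1} \<rparr>"

definition word_le :: "bool list \<Rightarrow> bool list \<Rightarrow> bool" where
  "word_le u v \<longleftrightarrow> length u = length v \<and> (\<forall>i < length u. u ! i \<le> v ! i)"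

definition daisy_cube :: "nat \<Rightarrow> bool list set \<Rightarrow> word_graph" where
  "daisy_cube n X = hypercube n \<restriction> {u \<in> verts (hypercube n). \<exists>x\<in>X. word_le u x}"

text \<open>
  The distance is the library's shortest-path cost for unit arc weights; it is extended-real
  valued, being infinite between different components.
\<close>

definition graph_dist :: "('a, 'b) pre_digraph \<Rightarrow> 'a \<Rightarrow> 'a \<Rightarrow> ereal" where
  "graph_dist G u v = wf_digraph.\<mu> G (\<lambda>_. 1) u v"

definition dist_to_subgraph ::
    "('a, 'b) pre_digraph \<Rightarrow> 'a \<Rightarrow> ('a, 'b) pre_digraph \<Rightarrow> ereal" where
  "dist_to_subgraph G u H = Min (graph_dist G u ` verts H)"

definition cube_count :: "('a, 'b) pre_digraph \<Rightarrow> nat \<Rightarrow> nat" where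
  "cube_count G k = card {H. induced_subgraph H G \<and> digraph_iso H (hypercube k)}"

definition dist_cube_count :: "('a, 'b) pre_digraph \<Rightarrow> 'a \<Rightarrow> nat \<Rightarrow> nat \<Rightarrow> nat" where
  "dist_cube_count G u k d =
     card {H. induced_subgraph H G \<and> digraph_iso H (hypercube k)
              \<and> dist_to_subgraph G u H = ereal (real d)}"

definition dist_count :: "('a, 'b) pre_digraph \<Rightarrow> 'a \<Rightarrow> nat \<Rightarrow> nat" where
  "dist_count G u d = card {v \<in> verts G. graph_dist G u v = ereal (real d)}"

text \<open>
  \<^const>\<open>Sum_any\<close> sums over the support of its argument, which is finite when \<open>G\<close> is finite.
\<close>

definition cube_poly :: "('a, 'b) pre_digraph \<Rightarrow> int poly" where
  "cube_poly G = Sum_any (\<lambda>k. monom (int (cube_count G k)) k)"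

text \<open>
  Polynomials in \<open>x\<close> and \<open>y\<close> are elements of \<open>\<int>[x][y]\<close>: the inner variable is \<open>x\<close>, the outer \<open>y\<close>.
\<close>

definition var_x :: "int poly poly" where
  "var_x = [:[:0, 1:]:]"

definition var_y :: "int poly poly" where
  "var_y = [:0, 1:]"

definition dist_cube_poly :: "('a, 'b) pre_digraph \<Rightarrow> 'a \<Rightarrow> int poly poly" where
  "dist_cube_poly G u =
     Sum_any (\<lambda>(k, d). of_nat (dist_cube_count G u k d) * var_x ^ k * var_y ^ d)"

definition dist_poly :: "('a, 'b) pre_digraph \<Rightarrow> 'a \<Rightarrow> int poly" where
  "dist_poly G u = Sum_any (\<lambda>d. monom (int (dist_count G u d)) d)"

text \<open>Substitution of an element of a commutative ring into an integer polynomial.\<close>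

definition subst_poly :: "int poly \<Rightarrow> 'a::comm_ring_1 \<Rightarrow> 'a" where
  "subst_poly p a = poly (map_poly of_int p) a"

end

theory Submission
  imports Defs
begin

text \<open>
  Identifying words with their supports turns \<open>G\<close> into a family \<open>F\<close> of sets that is closed under
  subsets. The distance from the empty set to \<open>S\<close> is the cardinality of \<open>S\<close>, and the induced
  \<open>k\<close>-cubes are exactly the intervals \<open>[B, T]\<close> with \<open>T \<in> F\<close> and \<open>|T| = |B| + k\<close>, at distance \<open>|B|\<close>
  from the empty set. A member \<open>T\<close> with \<open>m\<close> elements is thus the top of \<open>m choose d\<close> cubes of
  dimension \<open>m - d\<close> at distance \<open>d\<close>, contributing \<open>(x + y)\<^sup>m\<close> by the binomial theorem.
\<close>

section \<open>Words and their supports\<close>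

definition supp :: "bool list \<Rightarrow> nat set" where
  "supp u = {i. i < length u \<and> u ! i}"

definition word :: "nat \<Rightarrow> nat set \<Rightarrow> bool list" where
  "word n S = map (\<lambda>i. i \<in> S) [0..<n]"

lemma length_word [simp]: "length (word n S) = n"
  by (simp add: word_def)

lemma supp_word [simp]: "S \<subseteq> {..<n} \<Longrightarrow> supp (word n S) = S"
  by (auto simp: supp_def word_def)

lemma word_supp [simp]: "length u = n \<Longrightarrow> word n (supp u) = u"
  by (auto simp: supp_def word_def intro: nth_equalityI)

lemma word_empty: "word n {} = replicate n False"
  by (auto simp: word_def intro: nth_equalityI)

lemma supp_subset: "length u = n \<Longrightarrow> supp u \<subseteq> {..<n}"
  by (auto simp: supp_def)

lemma inj_on_word: "inj_on (word n) (Pow {..<n})"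
  by (rule inj_on_inverseI[of _ supp]) auto

lemma word_le_iff: "word_le u v \<longleftrightarrow> length u = length v \<and> supp u \<subseteq> supp v"
  by (auto simp: word_le_def supp_def)

lemma diff_positions_eq:
  assumes "length u = n" "length v = n"
  shows "{i. i < n \<and> u ! i \<noteq> v ! i} = sym_diff (supp u) (supp v)"
  using assms by (auto simp: supp_def)

lemma verts_hypercube [simp]: "verts (hypercube n) = {u. length u = n}"
  and tail_hypercube [simp]: "tail (hypercube n) = fst"
  and head_hypercube [simp]: "head (hypercube n) = snd"
  by (simp_all add: hypercube_def)

lemma arcs_hypercube:
  "arcs (hypercube n) =
    {(u, v). length u = n \<and> length v = n \<and> card (sym_diff (supp u) (supp v)) = 1}"
  unfolding hypercube_def by (simp cong: conj_cong add: diff_positions_eq del: not_iff)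

lemma wf_hypercube: "wf_digraph (hypercube n)"
  by unfold_locales (auto simp: arcs_hypercube)

section \<open>Symmetric differences and embeddings of Boolean lattices\<close>

lemma sym_diff_insert: "x \<notin> Y \<Longrightarrow> sym_diff V (insert x Y) = sym_diff (sym_diff V Y) {x}"
  by blast

text \<open>The symmetric difference of \<open>F\<close> and \<open>W\<close> is both that of
  \<open>{b}\<close> and \<open>{p}\<close> and that of \<open>{a}\<close> and \<open>{q}\<close>.
  As it is nonempty, it equals \<open>{b, p}\<close> and contains \<open>a\<close>, which forces
  \<open>p = a\<close>. In the embedding lemma it identifies the top corner of a square whose other
  three corners are known.\<close>

lemma common_neighbour:
  fixes W F :: "'a set"
  assumes "F = sym_diff (sym_diff W {b}) {p}" "F = sym_diff (sym_diff W {a}) {q}"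
    and "a \<noteq> b" "F \<noteq> W"
  shows "F = sym_diff W {a, b}"
proof -
  have "p \<noteq> b" using assms(1,4) by blast
  moreover have "p = b \<or> p = a" using assms(1-3) by blast
  ultimately show ?thesis using assms(1,3) by blast
qed

lemma card_sym_diff_1E:
  assumes "card (sym_diff X Y) = 1"
  obtains p where "Y = sym_diff X {p}"
proof -
  obtain p where "sym_diff X Y = {p}" using assms card_1_singletonE by metis
  then have "Y = sym_diff X {p}" by blast
  then show ?thesis by (rule that)
qed

text \<open>
  Two vertices at distance two in a Boolean lattice have exactly two common neighbours, so an
  injective edge-preserving map is determined by its values on the empty set and on singletons.
\<close>

lemma cube_embedding_image:
  fixes f :: "'a set \<Rightarrow> 'b set"
  assumes fin: "finite I" and inj: "inj_on f (Pow I)"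
    and adj: "\<And>S i. i \<in> I \<Longrightarrow> S \<subseteq> I - {i} \<Longrightarrow> card (sym_diff (f S) (f (insert i S))) = 1"
  obtains A where "finite A" "card A = card I" "f ` Pow I = sym_diff (f {}) ` Pow A"
proof -
  \<comment> \<open>The implication sits under the quantifier so that a total choice function
    \<open>a\<close> exists; \<open>a i\<close> is the direction in which \<open>f\<close> moves
    when \<open>i\<close> is added to the empty set.\<close>
  have "\<exists>p. i \<in> I \<longrightarrow> f {i} = sym_diff (f {}) {p}" for i
    using adj[of i "{}"] by (metis card_sym_diff_1E empty_subsetI)
  then obtain a where a: "\<And>i. i \<in> I \<Longrightarrow> f {i} = sym_diff (f {}) {a i}" by metis
  have inj_a: "inj_on a I"
  proof (rule inj_onI)
    fix i j assume "i \<in> I" "j \<in> I" "a i = a j"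
    then have "f {i} = f {j}" using a by simp
    then show "i = j" using inj \<open>i \<in> I\<close> \<open>j \<in> I\<close> by (auto dest: inj_onD)
  qed
  \<comment> \<open>Strong induction on \<open>S\<close>: a set with two elements \<open>i\<close>,
    \<open>j\<close> is the top of a square with lower corners \<open>R\<close>,
    \<open>insert i R\<close>, \<open>insert j R\<close>, all proper subsets of
    \<open>S\<close>.\<close>
  have val: "f S = sym_diff (f {}) (a ` S)" if "S \<subseteq> I" for S
    using finite_subset[OF that fin] that
  proof (induction S rule: finite_psubset_induct)
    case (psubset S)
    show ?case
    proof (cases "\<exists>i\<in>S. \<exists>j\<in>S. i \<noteq> j")
      case False
      then consider "S = {}" | i where "S = {i}" "i \<in> I" using psubset.prems by blast
      then show ?thesis by cases (auto simp: a)
    next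
      case True
      then obtain i j where ij: "i \<in> S" "j \<in> S" "i \<noteq> j" by blast
      define R where "R = S - {i, j}"
      have S: "S = insert i (insert j R)" "i \<notin> insert j R" "j \<notin> insert i R" "j \<notin> R"
        using ij by (auto simp: R_def)
      have R: "f R = sym_diff (f {}) (a ` R)" "f (insert i R) = sym_diff (f {}) (a ` insert i R)"
        "f (insert j R) = sym_diff (f {}) (a ` insert j R)"
        using S psubset.prems by (intro psubset.IH; blast)+
      have aR: "a i \<notin> a ` R" "a j \<notin> a ` R" "a i \<noteq> a j"
        using inj_a S psubset.prems by (auto dest!: inj_onD)
      have Ri: "f (insert i R) = sym_diff (f R) {a i}"
        using R(1,2) sym_diff_insert[OF aR(1)] by simp
      have Rj: "f (insert j R) = sym_diff (f R) {a j}"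
        using R(1,3) sym_diff_insert[OF aR(2)] by simp
      have "card (sym_diff (f (insert j R)) (f S)) = 1"
        using adj[of i "insert j R"] S psubset.prems by blast
      then obtain p where p: "f S = sym_diff (f (insert j R)) {p}" by (rule card_sym_diff_1E)
      have "S = insert j (insert i R)" using S by auto
      then have "card (sym_diff (f (insert i R)) (f S)) = 1"
        using adj[of j "insert i R"] S psubset.prems by blast
      then obtain q where q: "f S = sym_diff (f (insert i R)) {q}" by (rule card_sym_diff_1E)
      \<comment> \<open>Of the two common neighbours of \<open>f (insert i R)\<close> and
        \<open>f (insert j R)\<close>, injectivity excludes \<open>f R\<close>.\<close>
      have "S \<noteq> R" "S \<in> Pow I" "R \<in> Pow I" using S psubset.prems by blast+
      then have neq: "f S \<noteq> f R" by (simp only: inj_on_eq_iff[OF inj] not_False_eq_True)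
      have "f S = sym_diff (f R) {a i, a j}"
        using p q aR(3) neq unfolding Ri Rj by (rule common_neighbour)
      also have "\<dots> = sym_diff (f (insert j R)) {a i}"
        unfolding Rj using aR(3) by (intro sym_diff_insert) simp
      also have "\<dots> = sym_diff (f {}) (insert (a i) (a ` insert j R))"
        unfolding R(3) using aR by (intro sym_diff_insert[symmetric]) simp
      finally show ?thesis by (simp only: S(1) image_insert)
    qed
  qed
  have "f ` Pow I = (\<lambda>S. sym_diff (f {}) (a ` S)) ` Pow I"
    by (rule image_cong[OF refl], rule val) simp
  also have "\<dots> = sym_diff (f {}) ` Pow (a ` I)"
    unfolding image_Pow_surj[OF refl, of a I, symmetric] image_image ..
  finally show ?thesis
    using that[of "a ` I"] fin inj_a by (simp add: card_image)
qed

text \<open>Symmetric difference with \<open>V\<close> is an involution, and changing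
  \<open>V\<close> only inside \<open>A\<close> yields exactly the sets between the two extremes.
  This turns the image of an embedding into an interval.\<close>

lemma sym_diff_image_Pow: "sym_diff V ` Pow A = {V - A..V \<union> A}"
proof
  show "{V - A..V \<union> A} \<subseteq> sym_diff V ` Pow A"
  proof
    fix S assume "S \<in> {V - A..V \<union> A}"
    then have "S = sym_diff V (sym_diff V S)" "sym_diff V S \<in> Pow A" by auto
    then show "S \<in> sym_diff V ` Pow A" by blast
  qed
qed auto

lemma card_interval_ends:
  assumes "finite V" "finite A"
  shows "card (V \<union> A) = card (V - A) + card A"
  using assms card_Un_disjoint[of "V - A" A] by (simp add: Un_Diff_cancel2 Int_commute Diff_disjoint)

lemma monom_of_nat: "monom (int c) k = of_nat c * [:0, 1:] ^ k"
  by (simp add: monom_altdef of_nat_poly)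

section \<open>Down-closed set families and their graphs\<close>

locale down_family =
  fixes n :: nat and F :: "nat set set"
  assumes F_subset: "F \<subseteq> Pow {..<n}"
    and empty_in_F: "{} \<in> F"
    and down_closed: "\<lbrakk>S \<in> F; R \<subseteq> S\<rbrakk> \<Longrightarrow> R \<in> F"
begin

definition graph :: word_graph where
  "graph = hypercube n \<restriction> word n ` F"

lemma F_bounded: "S \<in> F \<Longrightarrow> S \<subseteq> {..<n}"
  using F_subset by blast

lemma finite_F: "finite F"
  using F_subset by (rule finite_subset) simp

lemma finite_in_F: "S \<in> F \<Longrightarrow> finite S"
  using F_bounded finite_subset by blast

lemma card_le: "S \<in> F \<Longrightarrow> card S \<le> n"
  using card_mono[OF _ F_bounded] by simp

lemma supp_word_F [simp]: "S \<in> F \<Longrightarrow> supp (word n S) = S"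
  using F_bounded by auto

lemma inj_on_word_F: "inj_on (word n) F"
  using inj_on_word F_subset by (rule inj_on_subset)

lemma graph_simps [simp]:
  "verts graph = word n ` F" "tail graph = fst" "head graph = snd"
  by (simp_all add: graph_def)

lemma word_arc_iff:
  "\<lbrakk>S \<in> F; T \<in> F\<rbrakk> \<Longrightarrow> (word n S, word n T) \<in> arcs graph \<longleftrightarrow> card (sym_diff S T) = 1"
  by (simp add: graph_def arcs_hypercube)

lemma arc_cases:
  assumes "e \<in> arcs graph"
  obtains S T where "e = (word n S, word n T)" "S \<in> F" "T \<in> F" "card (sym_diff S T) = 1"
proof -
  have "fst e \<in> word n ` F" "snd e \<in> word n ` F"
    using assms by (simp_all add: graph_def)
  then obtain S T where "e = (word n S, word n T)" "S \<in> F" "T \<in> F"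
    by (metis imageE prod.collapse)
  then show ?thesis using that assms word_arc_iff by blast
qed

sublocale wf_digraph graph
  unfolding graph_def by (rule wf_digraph.wellformed_induce_subgraph[OF wf_hypercube])

section \<open>Distances from the empty set\<close>

text \<open>Each arc changes one element, so a step raises the cardinality by at most one. From the
  empty set this bounds the distance from below.\<close>

lemma card_le_length_awalk:
  "awalk (word n S) p (word n T) \<Longrightarrow> S \<in> F \<Longrightarrow> T \<in> F \<Longrightarrow> card T \<le> card S + length p"
proof (induction p arbitrary: S)
  case Nil
  then show ?case using inj_on_word_F by (auto simp: awalk_Nil_iff dest: inj_onD)
next
  case (Cons e p)
  then have e: "e \<in> arcs graph" "fst e = word n S" and p: "awalk (snd e) p (word n T)"
    by (simp_all add: awalk_Cons_iff)
  from e(1) obtain S' R where SR: "e = (word n S', word n R)" "S' \<in> F" "R \<in> F"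
    "card (sym_diff S' R) = 1" by (rule arc_cases)
  then have "S' = S" using e(2) Cons.prems(2) inj_on_word_F by (auto dest: inj_onD)
  then have "card (sym_diff S R) = 1" using SR(4) by simp
  moreover have "card R \<le> card (S \<union> sym_diff S R)"
    using Cons.prems(2) SR(3) finite_in_F by (intro card_mono) auto
  ultimately have "card R \<le> card S + 1"
    using card_Un_le[of S "sym_diff S R"] by linarith
  moreover have "card T \<le> card R + length p" using Cons p SR by simp
  ultimately show ?case by simp
qed

text \<open>The elements of \<open>S\<close> are added one at a time; down-closure keeps every
  intermediate set in \<open>F\<close>. This bounds the distance from above.\<close>

lemma awalk_from_empty:
  assumes "S \<in> F"
  shows "\<exists>p. awalk (word n {}) p (word n S) \<and> length p = card S"
  using finite_in_F[OF assms] assms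
proof (induction S rule: finite_induct)
  case empty
  then show ?case by (intro exI[of _ "[]"]) (auto simp: awalk_Nil_iff)
next
  case (insert i S)
  have S: "S \<in> F" using insert.prems down_closed by blast
  then obtain p where p: "awalk (word n {}) p (word n S)" "length p = card S"
    using insert.IH by blast
  have "sym_diff S (insert i S) = {i}" using insert.hyps by blast
  then have arc: "(word n S, word n (insert i S)) \<in> arcs graph"
    using S insert.prems by (subst word_arc_iff) simp_all
  then have "awalk (word n S) [(word n S, word n (insert i S))] (word n (insert i S))"
    using insert.prems by (simp add: awalk_Cons_iff awalk_Nil_iff)
  with p(1) have "awalk (word n {}) (p @ [(word n S, word n (insert i S))]) (word n (insert i S))"
    by (rule awalk_appendI)
  moreover have "length (p @ [(word n S, word n (insert i S))]) = card (insert i S)"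
    using p(2) insert.hyps by simp
  ultimately show ?case by blast
qed

lemma awalk_cost_unit: "awalk_cost (\<lambda>_. 1) p = real (length p)"
  by (induction p) auto

lemma graph_dist_word:
  assumes "S \<in> F"
  shows "graph_dist graph (word n {}) (word n S) = ereal (real (card S))"
proof (rule antisym)
  obtain p where "awalk (word n {}) p (word n S)" "length p = card S"
    using awalk_from_empty[OF assms] by blast
  then show "graph_dist graph (word n {}) (word n S) \<le> ereal (real (card S))"
    using min_cost_le_walk_cost[of "word n {}" p "word n S" "\<lambda>_. 1"]
    by (simp add: graph_dist_def awalk_cost_unit)
next
  have "card S \<le> length p" if "awalk (word n {}) p (word n S)" for p
    using card_le_length_awalk[OF that empty_in_F assms] by simp
  then show "ereal (real (card S)) \<le> graph_dist graph (word n {}) (word n S)"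
    by (auto simp: graph_dist_def \<mu>_def awalk_cost_unit intro!: INF_greatest)
qed

lemma dist_count_eq: "dist_count graph (word n {}) d = card {S \<in> F. card S = d}"
proof -
  have "{v \<in> verts graph. graph_dist graph (word n {}) v = ereal (real d)}
      = word n ` {S \<in> F. card S = d}"
    by (auto simp: graph_dist_word)
  moreover have "inj_on (word n) {S \<in> F. card S = d}"
    using inj_on_word_F by (rule inj_on_subset) blast
  ultimately show ?thesis by (simp add: dist_count_def card_image)
qed

section \<open>Intervals as induced cubes\<close>

definition subcube :: "nat set \<Rightarrow> nat set \<Rightarrow> word_graph" where
  "subcube B T = graph \<restriction> word n ` {B..T}"

lemma interval_subset: "T \<in> F \<Longrightarrow> {B..T} \<subseteq> F"
  using down_closed by auto

lemma induced_subcube: "T \<in> F \<Longrightarrow> induced_subgraph (subcube B T) graph"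
  unfolding subcube_def using interval_subset by (intro induced_induce) auto

text \<open>The vertex set determines the interval, and a nonempty interval determines its ends;
  hence cubes can be counted by pairs of ends.\<close>

lemma subcube_inject:
  assumes "T \<in> F" "B \<subseteq> T" "T' \<in> F" "B' \<subseteq> T'" "subcube B T = subcube B' T'"
  shows "B = B' \<and> T = T'"
proof -
  have "word n ` {B..T} = word n ` {B'..T'}"
    using assms(5) by (metis subcube_def induce_subgraph_verts)
  then have "{B..T} = {B'..T'}"
    using inj_on_word_F interval_subset assms(1,3) by (metis inj_on_image_eq_iff)
  then show ?thesis using assms(2,4) by (simp add: Icc_eq_Icc)
qed

text \<open>Every member of the interval contains \<open>B\<close>, so the minimum is attained at
  the bottom.\<close>

lemma dist_to_subcube:
  assumes "T \<in> F" "B \<subseteq> T"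
  shows "dist_to_subgraph graph (word n {}) (subcube B T) = ereal (real (card B))"
proof -
  have "graph_dist graph (word n {}) ` verts (subcube B T) = (\<lambda>S. ereal (real (card S))) ` {B..T}"
    unfolding subcube_def induce_subgraph_verts image_image
    using interval_subset[OF assms(1)] graph_dist_word by (intro image_cong) blast+
  moreover have "Min ((\<lambda>S. ereal (real (card S))) ` {B..T}) = ereal (real (card B))"
  proof (rule Min_eqI)
    show "finite ((\<lambda>S. ereal (real (card S))) ` {B..T})"
      using interval_subset[OF assms(1)] finite_F finite_subset by blast
    show "ereal (real (card B)) \<in> (\<lambda>S. ereal (real (card S))) ` {B..T}"
      using assms(2) by auto
  next
    fix y assume "y \<in> (\<lambda>S. ereal (real (card S))) ` {B..T}"
    then obtain S where "y = ereal (real (card S))" "B \<subseteq> S" "S \<subseteq> T" by auto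
    then show "ereal (real (card B)) \<le> y"
      using finite_in_F[OF assms(1)] by (simp add: card_mono finite_subset)
  qed
  ultimately show ?thesis by (simp add: dist_to_subgraph_def)
qed

text \<open>A numbering \<open>a\<close> of \<open>T - B\<close> serves as a coordinate system: the
  word \<open>u\<close> goes to \<open>B\<close> together with the elements numbered by its support.
  Sizes of symmetric differences, and with them adjacency, are preserved.\<close>

lemma subcube_iso:
  assumes T: "T \<in> F" and BT: "B \<subseteq> T" and card: "card T = card B + k"
  shows "digraph_iso (subcube B T) (hypercube k)"
proof (rule digraph_iso_swap[OF wf_hypercube])
  have fin: "finite T" using T by (rule finite_in_F)
  have "card (T - B) = k"
    using card card_Diff_subset[OF finite_subset[OF BT fin] BT] by simp
  then obtain a where a: "bij_betw a {..<k} (T - B)"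
    using ex_bij_betw_nat_finite[of "T - B"] fin by (metis finite_Diff atLeast0LessThan)
  define g where "g S = B \<union> a ` S" for S
  define f where "f u = word n (g (supp u))" for u
  have inj_a: "inj_on a {..<k}" and im_a: "a ` {..<k} = T - B"
    using a by (auto simp: bij_betw_def)
  \<comment> \<open>The common part \<open>B\<close> cancels because \<open>a\<close> avoids it, and
    injectivity lets the image commute with differences.\<close>
  have sd: "sym_diff (g S) (g R) = a ` sym_diff S R" if "S \<subseteq> {..<k}" "R \<subseteq> {..<k}" for S R
  proof -
    have "a ` S \<inter> B = {}" "a ` R \<inter> B = {}" using im_a that by auto
    moreover have "a ` S - a ` R = a ` (S - R)" "a ` R - a ` S = a ` (R - S)"
      using inj_on_image_set_diff[OF inj_a, of S R] inj_on_image_set_diff[OF inj_a, of R S] that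
      by blast+
    ultimately show ?thesis unfolding g_def by blast
  qed
  have card_sd: "card (sym_diff (g S) (g R)) = card (sym_diff S R)"
    if "S \<subseteq> {..<k}" "R \<subseteq> {..<k}" for S R
  proof -
    have "inj_on a (sym_diff S R)" using inj_a that by (auto intro: inj_on_subset)
    then show ?thesis using sd[OF that] by (simp add: card_image)
  qed
  have g_Pow: "g ` Pow {..<k} = {B..T}"
  proof -
    have "g ` Pow {..<k} = (\<union>) B ` Pow (T - B)"
      unfolding g_def im_a[symmetric] by (simp only: image_Pow_surj[OF refl, symmetric] image_image)
    also have "\<dots> = {B..T}"
    proof
      show "{B..T} \<subseteq> (\<union>) B ` Pow (T - B)"
      proof
        fix S assume "S \<in> {B..T}"
        then have "S = B \<union> (S - B)" "S - B \<in> Pow (T - B)" by auto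
        then show "S \<in> (\<union>) B ` Pow (T - B)" by blast
      qed
    qed (use BT in auto)
    finally show ?thesis .
  qed
  have g_F: "g S \<in> F" if "S \<subseteq> {..<k}" for S
    using g_Pow interval_subset[OF T] that by blast
  have words: "supp ` {u. length u = k} = Pow {..<k}"
  proof
    show "Pow {..<k} \<subseteq> supp ` {u. length u = k}"
    proof
      fix S assume "S \<in> Pow {..<k}"
      then have "S = supp (word k S)" by auto
      then show "S \<in> supp ` {u. length u = k}"
        using image_eqI[of S supp "word k S"] by simp
    qed
  qed (auto simp: supp_def)
  have f_verts: "f ` {u. length u = k} = word n ` {B..T}"
    unfolding f_def g_Pow[symmetric] words[symmetric] by (simp add: image_image)
  have inj_f: "inj_on f {u. length u = k}"
  proof (rule inj_onI)
    fix u v assume uv: "u \<in> {u. length u = k}" "v \<in> {u. length u = k}" "f u = f v"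
    then have s: "supp u \<subseteq> {..<k}" "supp v \<subseteq> {..<k}" by (auto simp: supp_def)
    then have "g (supp u) = g (supp v)"
      using uv(3) inj_on_word_F g_F by (auto simp: f_def dest: inj_onD)
    then have "a ` sym_diff (supp u) (supp v) = {}" using sd[OF s] by simp
    then have "supp u = supp v" by blast
    then show "u = v" using uv by (metis word_supp mem_Collect_eq)
  qed
  have f_arc: "(f u, f v) \<in> arcs graph \<longleftrightarrow> (u, v) \<in> arcs (hypercube k)"
    if "length u = k" "length v = k" for u v
    using that g_F[OF supp_subset] card_sd[OF supp_subset supp_subset]
    by (simp add: f_def word_arc_iff arcs_hypercube)
  \<comment> \<open>Arcs are pairs of words, so the arc map is the vertex map on both components,
    with \<open>fst\<close> and \<open>snd\<close> still giving tail and head.\<close>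
  define h where "h = \<lparr>iso_verts = f, iso_arcs = map_prod f f, iso_head = snd, iso_tail = fst\<rparr>"
  have arcs_sub: "arcs (hypercube k) \<subseteq> {u. length u = k} \<times> {u. length u = k}"
    by (auto simp: arcs_hypercube)
  have iso: "pre_digraph.digraph_isomorphism (hypercube k) h"
    unfolding pre_digraph.digraph_isomorphism_def h_def
    using wf_hypercube inj_f inj_on_subset[OF map_prod_inj_on[OF inj_f inj_f] arcs_sub]
    by simp
  have arcs: "map_prod f f ` arcs (hypercube k) = arcs (subcube B T)"
  proof
    show "map_prod f f ` arcs (hypercube k) \<subseteq> arcs (subcube B T)"
    proof
      fix e assume "e \<in> map_prod f f ` arcs (hypercube k)"
      then obtain u v where uv: "e = (f u, f v)" "(u, v) \<in> arcs (hypercube k)" by auto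
      then have "length u = k" "length v = k" using arcs_sub by auto
      then have "f u \<in> word n ` {B..T}" "f v \<in> word n ` {B..T}" "e \<in> arcs graph"
        using uv f_arc unfolding f_verts[symmetric] by simp_all
      then show "e \<in> arcs (subcube B T)" using uv(1) by (simp add: subcube_def)
    qed
    show "arcs (subcube B T) \<subseteq> map_prod f f ` arcs (hypercube k)"
    proof
      fix e assume e: "e \<in> arcs (subcube B T)"
      then have "fst e \<in> f ` {u. length u = k}" "snd e \<in> f ` {u. length u = k}"
        "e \<in> arcs graph"
        unfolding f_verts by (simp_all add: subcube_def)
      then obtain u v where uv: "fst e = f u" "snd e = f v" "length u = k" "length v = k"
        by blast
      then have "e = map_prod f f (u, v)" by (simp add: prod_eq_iff)
      moreover have "(u, v) \<in> arcs (hypercube k)"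
        using calculation uv f_arc \<open>e \<in> arcs graph\<close> by simp
      ultimately show "e \<in> map_prod f f ` arcs (hypercube k)" by (rule image_eqI)
    qed
  qed
  have "verts (subcube B T) = iso_verts h ` verts (hypercube k)" "tail (subcube B T) = iso_tail h"
    "head (subcube B T) = iso_head h" "arcs (subcube B T) = iso_arcs h ` arcs (hypercube k)"
    using f_verts arcs by (simp_all add: h_def subcube_def)
  then have "subcube B T = app_iso h (hypercube k)"
    by (intro pre_digraph.equality) simp_all
  with iso show "digraph_iso (hypercube k) (subcube B T)"
    unfolding digraph_iso_def by blast
qed

section \<open>Every induced cube is an interval\<close>

text \<open>Read through supports, an isomorphism from the cube onto \<open>H\<close> is an
  injective edge-preserving map \<open>f\<close> on a power set. By
  \<open>cube_embedding_image\<close> its image is a translated power set, hence an interval, and an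
  induced subgraph is determined by its vertices.\<close>

lemma induced_cube_is_subcube:
  assumes ind: "induced_subgraph H graph" and iso: "digraph_iso H (hypercube k)"
  obtains B T where "T \<in> F" "B \<subseteq> T" "card T = card B + k" "H = subcube B T"
proof -
  have sub: "subgraph H graph" using ind by (rule induced_imp_subgraph)
  then have H: "tail H = fst" "head H = snd" "arcs H \<subseteq> arcs graph" "verts H \<subseteq> word n ` F" "wf_digraph H"
    by (auto simp: subgraph_def compatible_def)
  obtain h where h: "pre_digraph.digraph_isomorphism (hypercube k) h" "H = app_iso h (hypercube k)"
    using digraph_iso_swap[OF H(5) iso] by (auto simp: digraph_iso_def)
  define f where "f S = supp (iso_verts h (word k S))" for S
  have verts_H: "verts H = iso_verts h ` {u. length u = k}" using h(2) by simp
  have verts_H': "verts H = (\<lambda>S. iso_verts h (word k S)) ` Pow {..<k}"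
    unfolding verts_H using supp_subset word_supp
    by (auto simp: image_iff) (metis PowI supp_subset word_supp)
  \<comment> \<open>This holds for every \<open>S\<close>, since \<open>word k S\<close> has length
    \<open>k\<close> whatever \<open>S\<close> is.\<close>
  have fF: "f S \<in> F \<and> word n (f S) = iso_verts h (word k S)" for S
  proof -
    have "iso_verts h (word k S) \<in> word n ` F" using verts_H H(4) by auto
    then show ?thesis by (auto simp: f_def)
  qed
  \<comment> \<open>The isomorphism carries a separate arc map; compatibility with tails and heads
    shows that the image of an arc joins the images of its ends.\<close>
  have arc: "(iso_verts h u, iso_verts h v) \<in> arcs graph" if "(u, v) \<in> arcs (hypercube k)" for u v
  proof -
    have "iso_arcs h (u, v) \<in> arcs graph" using that h(2) H(3) by auto
    moreover have "iso_tail h = fst" "iso_head h = snd" using H(1,2) h(2) by simp_all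
    then have "fst (iso_arcs h (u, v)) = iso_verts h u" "snd (iso_arcs h (u, v)) = iso_verts h v"
      using h(1) that by (auto simp: pre_digraph.digraph_isomorphism_def)
    ultimately show ?thesis by (metis prod.collapse)
  qed
  have "inj_on f (Pow {..<k})"
  proof (rule inj_onI)
    fix S R assume SR: "S \<in> Pow {..<k}" "R \<in> Pow {..<k}" "f S = f R"
    then have "iso_verts h (word k S) = iso_verts h (word k R)" using fF by metis
    then have "word k S = word k R"
      using h(1) by (auto simp: pre_digraph.digraph_isomorphism_def dest: inj_onD)
    then show "S = R" using inj_on_word SR by (auto dest: inj_onD)
  qed
  moreover have "card (sym_diff (f S) (f (insert i S))) = 1" if "i \<in> {..<k}" "S \<subseteq> {..<k} - {i}" for S i
  proof -
    have "S \<subseteq> {..<k}" "insert i S \<subseteq> {..<k}" using that by auto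
    then have "supp (word k S) = S" "supp (word k (insert i S)) = insert i S"
      by (simp_all only: supp_word)
    moreover have "sym_diff S (insert i S) = {i}" using that by auto
    ultimately have "(word k S, word k (insert i S)) \<in> arcs (hypercube k)"
      by (simp add: arcs_hypercube)
    then show ?thesis using arc fF word_arc_iff by metis
  qed
  ultimately obtain A
    where A: "finite A" "card A = card {..<k}" "f ` Pow {..<k} = sym_diff (f {}) ` Pow A"
    by (rule cube_embedding_image[OF finite_lessThan])
  define B T where "B = f {} - A" and "T = f {} \<union> A"
  have im: "f ` Pow {..<k} = {B..T}" using A(3) sym_diff_image_Pow[of "f {}" A] by (simp add: B_def T_def)
  have "B \<subseteq> T" by (auto simp: B_def T_def)
  \<comment> \<open>The top of the interval is itself a value of \<open>f\<close>, which places it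
    in \<open>F\<close>.\<close>
  then have "T \<in> f ` Pow {..<k}" unfolding im by simp
  then have "T \<in> F" using fF by auto
  moreover have "card T = card B + k"
    unfolding B_def T_def using card_interval_ends[of "f {}" A] A fF finite_in_F by auto
  moreover have "verts H = word n ` {B..T}"
    unfolding im[symmetric] verts_H' image_image using fF by simp
  then have "H = subcube B T"
    using induce_eq_iff_induced[OF ind] by (simp add: subcube_def)
  ultimately show ?thesis using \<open>B \<subseteq> T\<close> that by blast
qed

section \<open>Counting cubes\<close>

text \<open>Pairs list the top first, so that counting them becomes a sum over
  \<open>F\<close>.\<close>

lemma induced_cubes_eq:
  "{H. induced_subgraph H graph \<and> digraph_iso H (hypercube k)} =
    (\<lambda>(T, B). subcube B T) ` (SIGMA T:F. {B. B \<subseteq> T \<and> card T = card B + k})"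
  using induced_subcube subcube_iso by (auto elim!: induced_cube_is_subcube)

text \<open>The arbitrary condition \<open>P\<close> lets one statement serve both counts.\<close>

lemma inj_on_subcube: "inj_on (\<lambda>(T, B). subcube B T) (SIGMA T:F. {B. B \<subseteq> T \<and> P T B})"
  using subcube_inject by (auto intro!: inj_onI)

text \<open>The distance fixes the size \<open>d\<close> of the bottom, so the top has
  \<open>k + d\<close> elements and the bottom is any of its \<open>d\<close>-subsets.\<close>

lemma dist_cube_count_eq:
  "dist_cube_count graph (word n {}) k d = dist_count graph (word n {}) (k + d) * ((k + d) choose d)"
proof -
  let ?S = "SIGMA T:{T \<in> F. card T = k + d}. {B. B \<subseteq> T \<and> card B = d}"
  have "{H. induced_subgraph H graph \<and> digraph_iso H (hypercube k)
          \<and> dist_to_subgraph graph (word n {}) H = ereal (real d)} =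
        {H \<in> (\<lambda>(T, B). subcube B T) ` (SIGMA T:F. {B. B \<subseteq> T \<and> card T = card B + k}).
          dist_to_subgraph graph (word n {}) H = ereal (real d)}"
    unfolding induced_cubes_eq[symmetric] by blast
  also have "\<dots> = (\<lambda>(T, B). subcube B T) ` ?S"
  proof
    show "(\<lambda>(T, B). subcube B T) ` ?S \<subseteq>
      {H \<in> (\<lambda>(T, B). subcube B T) ` (SIGMA T:F. {B. B \<subseteq> T \<and> card T = card B + k}).
        dist_to_subgraph graph (word n {}) H = ereal (real d)}"
      by (force simp: dist_to_subcube)
  qed (auto simp: dist_to_subcube)
  finally have "dist_cube_count graph (word n {}) k d = card ((\<lambda>(T, B). subcube B T) ` ?S)"
    by (simp add: dist_cube_count_def)
  also have "\<dots> = card ?S"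
    by (intro card_image inj_on_subset[OF inj_on_subcube[of "\<lambda>_ _. True"]]) auto
  also have "\<dots> = (\<Sum>T\<in>{T \<in> F. card T = k + d}. (k + d) choose d)"
    using finite_F finite_in_F by (subst card_SigmaI) (auto simp: n_subsets)
  finally show ?thesis by (simp add: dist_count_eq)
qed

text \<open>Below a fixed top \<open>T\<close>, the bottoms are the complements in \<open>T\<close>
  of its \<open>k\<close>-subsets; the tops are then grouped by size.\<close>

lemma cube_count_eq: "cube_count graph k = (\<Sum>m\<le>n. dist_count graph (word n {}) m * (m choose k))"
proof -
  have card_fibre: "card {B. B \<subseteq> T \<and> card T = card B + k} = card T choose k" if "T \<in> F" for T
  proof (cases "k \<le> card T")
    case True
    then have "{B. B \<subseteq> T \<and> card T = card B + k} = {B. B \<subseteq> T \<and> card B = card T - k}" by auto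
    then show ?thesis using that finite_in_F True by (simp add: n_subsets binomial_symmetric[symmetric])
  next
    \<comment> \<open>The fibre is empty and the binomial coefficient is zero.\<close>
    case False
    then show ?thesis by simp
  qed
  have "cube_count graph k = card (SIGMA T:F. {B. B \<subseteq> T \<and> card T = card B + k})"
    unfolding cube_count_def induced_cubes_eq by (rule card_image[OF inj_on_subcube])
  also have "\<dots> = (\<Sum>T\<in>F. card T choose k)"
    using finite_F finite_in_F card_fibre by (subst card_SigmaI) auto
  also have "\<dots> = (\<Sum>m\<le>n. \<Sum>T\<in>{T \<in> F. card T = m}. card T choose k)"
    using card_le by (intro sum.group[symmetric] finite_F) auto
  also have "\<dots> = (\<Sum>m\<le>n. dist_count graph (word n {}) m * (m choose k))"
    by (simp add: dist_count_eq)
  finally show ?thesis .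
qed

section \<open>The polynomials as finite sums\<close>

lemma dist_count_eq_0: "m > n \<Longrightarrow> dist_count graph (word n {}) m = 0"
  using card_le finite_F by (auto simp: dist_count_eq dest!: leD)

lemma dist_poly_eq:
  "dist_poly graph (word n {}) = (\<Sum>m\<le>n. monom (int (dist_count graph (word n {}) m)) m)"
  unfolding dist_poly_def using dist_count_eq_0
  by (intro Sum_any.expand_superset) (auto simp flip: not_less)

lemma dist_cube_poly_eq:
  "dist_cube_poly graph (word n {}) =
    (\<Sum>m\<le>n. of_nat (dist_count graph (word n {}) m) * (var_x + var_y) ^ m)"
proof -
  define w where "w = dist_count graph (word n {})"
  have w0: "w m = 0" if "m > n" for m
    using that by (simp add: w_def dist_count_eq_0)
  define t where "t k d = of_nat (w (k + d) * ((k + d) choose d)) * var_x ^ k * var_y ^ d" for k d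
  have "{(k, d). k + d \<le> n} \<subseteq> {..n} \<times> {..n}" by auto
  then have fin: "finite {(k, d). k + d \<le> n}" by (rule finite_subset) simp
  have "dist_cube_poly graph (word n {}) = Sum_any (\<lambda>(k, d). t k d)"
    by (simp add: dist_cube_poly_def dist_cube_count_eq w_def t_def)
  \<comment> \<open>Outside this triangle \<open>w (k + d)\<close> vanishes, so the support is
    contained in a finite set.\<close>
  also have "\<dots> = (\<Sum>(k, d)\<in>{(k, d). k + d \<le> n}. t k d)"
    using fin w0 by (intro Sum_any.expand_superset) (auto simp: t_def simp flip: not_less)
  \<comment> \<open>Summing along the diagonals \<open>k + d = m\<close> makes each inner sum a
    binomial expansion.\<close>
  also have "\<dots> = (\<Sum>m\<le>n. \<Sum>k\<le>m. t k (m - k))"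
    by (rule sum.triangle_reindex_eq)
  also have "\<dots> = (\<Sum>m\<le>n. of_nat (w m) * (var_x + var_y) ^ m)"
    unfolding binomial_ring sum_distrib_left
    by (intro sum.cong refl) (auto simp: t_def mult.assoc binomial_symmetric[symmetric])
  finally show ?thesis by (simp add: w_def)
qed

lemma cube_poly_eq:
  "cube_poly graph = (\<Sum>m\<le>n. of_nat (dist_count graph (word n {}) m) * ([:0, 1:] + 1) ^ m)"
proof -
  define w where "w = dist_count graph (word n {})"
  have c: "cube_count graph k = (\<Sum>m\<le>n. w m * (m choose k))" for k
    by (simp add: cube_count_eq w_def)
  then have c0: "cube_count graph k = 0" if "k > n" for k
    using that by (simp add: sum.neutral)
  have "cube_poly graph = (\<Sum>k\<le>n. monom (int (cube_count graph k)) k)"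
    unfolding cube_poly_def using c0 by (intro Sum_any.expand_superset) (auto simp flip: not_less)
  also have "\<dots> = (\<Sum>k\<le>n. \<Sum>m\<le>n. of_nat (w m * (m choose k)) * [:0, 1:] ^ k)"
    unfolding monom_of_nat unfolding c of_nat_sum sum_distrib_right ..
  also have "\<dots> = (\<Sum>m\<le>n. \<Sum>k\<le>n. of_nat (w m * (m choose k)) * [:0, 1:] ^ k)"
    by (rule sum.swap)
  \<comment> \<open>Terms with \<open>k > m\<close> have a zero binomial coefficient; cutting them
    off leaves the expansion of a power of \<open>[:0, 1:] + 1\<close>.\<close>
  also have "\<dots> = (\<Sum>m\<le>n. \<Sum>k\<le>m. of_nat (w m * (m choose k)) * [:0, 1:] ^ k)"
    by (intro sum.cong refl sum.mono_neutral_right) auto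
  also have "\<dots> = (\<Sum>m\<le>n. of_nat (w m) * ([:0, 1:] + 1) ^ m)"
    unfolding binomial_ring by (simp add: sum_distrib_left mult.assoc)
  finally show ?thesis by (simp add: w_def)
qed

end

section \<open>Substitution and the conclusion for daisy cubes\<close>

lemma subst_poly_0 [simp]: "subst_poly 0 a = 0"
  by (simp add: subst_poly_def)

lemma subst_poly_add: "subst_poly (p + q) a = subst_poly p a + subst_poly q a"
proof -
  have "map_poly of_int (p + q) = map_poly of_int p + (map_poly of_int q :: 'a poly)"
    by (rule poly_eqI) (simp add: coeff_map_poly)
  then show ?thesis by (simp add: subst_poly_def)
qed

lemma subst_poly_sum: "subst_poly (sum f A) a = (\<Sum>i\<in>A. subst_poly (f i) a)"
  by (induction A rule: infinite_finite_induct) (simp_all add: subst_poly_add)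

lemma subst_poly_monom: "subst_poly (monom c m) a = of_int c * a ^ m"
  by (simp add: subst_poly_def map_poly_monom poly_monom)

theorem corollary3p6:
  fixes n :: nat and X :: "bool list set" and G :: word_graph
  assumes "X \<subseteq> {w. length w = n}"
    and "X \<noteq> {}"
    and "G = daisy_cube n X"
  shows "dist_cube_poly G (replicate n False) =
           subst_poly (dist_poly G (replicate n False)) (var_x + var_y)
       \<and> cube_poly G = subst_poly (dist_poly G (replicate n False)) ([:0, 1:] + 1)"
proof -
  \<comment> \<open>The supports of the vertices of the daisy cube: everything below the support of
    some generator. Nonemptiness of \<open>X\<close> puts the empty set in \<open>F\<close>.\<close>
  define F where "F = {S. \<exists>x\<in>X. S \<subseteq> supp x}"
  interpret down_family n F
  proof
    show "F \<subseteq> Pow {..<n}" using assms(1) supp_subset by (fastforce simp: F_def)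
    show "{} \<in> F" using assms(2) by (auto simp: F_def)
  qed (auto simp: F_def)
  have "{u \<in> verts (hypercube n). \<exists>x\<in>X. word_le u x} = word n ` F"
  proof
    show "{u \<in> verts (hypercube n). \<exists>x\<in>X. word_le u x} \<subseteq> word n ` F"
    proof
      fix u assume "u \<in> {u \<in> verts (hypercube n). \<exists>x\<in>X. word_le u x}"
      then have "u = word n (supp u)" "supp u \<in> F" by (auto simp: F_def word_le_iff)
      then show "u \<in> word n ` F" by (rule image_eqI)
    qed
    show "word n ` F \<subseteq> {u \<in> verts (hypercube n). \<exists>x\<in>X. word_le u x}"
    proof
      fix u assume "u \<in> word n ` F"
      then obtain S x where S: "u = word n S" "S \<in> F" "x \<in> X" "S \<subseteq> supp x"
        by (auto simp: F_def)
      then have "word_le u x" using assms(1) by (auto simp: word_le_iff)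
      with S show "u \<in> {u \<in> verts (hypercube n). \<exists>x\<in>X. word_le u x}" by auto
    qed
  qed
  then have G: "G = graph"
    by (simp add: assms(3) daisy_cube_def graph_def)
  \<comment> \<open>Substitution is additive and acts on monomials termwise, so both identities
    become equalities of the same finite sums over \<open>m\<close>.\<close>
  show ?thesis
    unfolding G word_empty[symmetric] dist_poly_eq dist_cube_poly_eq cube_poly_eq
    by (simp add: subst_poly_sum subst_poly_monom)
qed

end
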